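(* Let $0<p\le\frac12$ ($p$ may depend on $n$). On input of a single-key guessing instance $(\mathrm{Ber}(p)^n,\mathbb{1}_k)$, Montanaro's algorithm asymptotically achieves a quantum speed-up $s$ over optimal classical key guessing (enumerating keys in decreasing order of probability) satisfying $$s\;\ge\;\frac13\,p^{-\frac16}.$$ Thus, for $p=\Theta(n^{-\frac12})$, Montanaro's algorithm achieves speed-up $s=\Omega(n^{\frac1{12}})$.
   Context: All logarithms are base 2. $\mathrm{Ber}(p)$ is the distribution on $\{0,1\}$ taking value $1$ with probability $p$ and $0$ with probability $1-p$; $\mathrm{Ber}(p)^n$ is the distribution on $\{0,1\}^n$ of $n$ independent such bits. Single-key guessing problem: for a key $k\leftarrow\mathcal{D}$, where $\mathcal{D}$ is a distribution with support $\mathcal{K}$, one is given a description of $\mathcal{D}$ and oracle access to $\mathbb{1}_k:\mathcal{K}\to\{0,1\}$, with $\mathbb{1}_k(x)=1$ if and only if $x=k$; the goal is to find $k$. Let $p_1\ge p_2\ge\dots$ be the probabilities of the keys in decreasing order. The optimal classical algorithm queries keys in decreasing order of probability and has expected runtime $T_C(\mathcal{D})=\sum_i i\,p_i$. Montanaro's algorithm is a quantum algorithm for this problem, optimal up to constant factors, whose expected runtime is (up to a constant factor, which is disregarded) $T_Q(\mathcal{D})=\sum_i\sqrt i\,p_i$. The quantum speed-up is $s=\frac{\log T_C(\mathcal{D})}{\log T_Q(\mathcal{D})}$, i.e. $T_C(\mathcal{D})=T_Q(\mathcal{D})^s$. Here $\mathcal{D}=\mathrm{Ber}(p)^n$, and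 "asymptotically" refers to growing $n$.
   Formalization: The bound s ≥ (1/3)p^(-1/6) is proved assuming p ≥ n^(-3) for all large n; without such a condition it is false, e.g. for p = 2^(-n), where s grows only like (3/4)√n. The claim for p = Θ(n^(-1/2)) needs no extra assumption. *)

theory Defs
  imports "HOL-Probability.Probability" "HOL-Library.Landau_Symbols"
begin

text \<open>Only distributions with finite support are considered: \<open>mset_set\<close> is empty on an
  infinite set.  Equal probabilities are kept with multiplicity.  Entry \<open>i\<close> of the list is the
  probability written p with index \<open>i + 1\<close> in the mathematical notation.\<close>

definition key_probs :: "'a pmf \<Rightarrow> real list" where
  "key_probs D = rev (sorted_list_of_multiset (image_mset (pmf D) (mset_set (set_pmf D))))"

text \<open>Expected number of oracle queries when the keys are enumerated in decreasing order of
  probability.\<close>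

definition T_C :: "'a pmf \<Rightarrow> real" where
  "T_C D = (\<Sum>i<length (key_probs D). real (i + 1) * key_probs D ! i)"

text \<open>Expected runtime of Montanaro's quantum algorithm, with the implied constant taken to be 1.\<close>

definition T_Q :: "'a pmf \<Rightarrow> real" where
  "T_Q D = (\<Sum>i<length (key_probs D). sqrt (real (i + 1)) * key_probs D ! i)"

definition quantum_speedup :: "'a pmf \<Rightarrow> real" where
  "quantum_speedup D = log 2 (T_C D) / log 2 (T_Q D)"

text \<open>Bit strings in \<open>{0,1}\<^sup>n\<close> are Boolean lists of length \<open>n\<close>, with \<open>True\<close> for 1.\<close>

definition Ber_pow :: "real \<Rightarrow> nat \<Rightarrow> bool list pmf" where
  "Ber_pow p n = replicate_pmf n (bernoulli_pmf p)"

end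

theory Submission
  imports Defs "HOL-Real_Asymp.Real_Asymp"
begin

text \<open>Write \<open>q = 1 - p\<close> and \<open>x = n \<surd>p\<close>.  Since \<open>2 T\<^sub>C = 1 + \<Sum> min (P k) (P k')\<close> over all pairs of keys
  \<open>k\<close>, \<open>k'\<close>, keeping only pairs of equal Hamming weight gives
  \<open>2 T\<^sub>C \<ge> 1 + \<Sum>\<^sub>k (n choose k)\<^sup>2 p\<^sup>k q\<^bsup>n-k\<^esup>\<close>.  In the other direction, a key of weight \<open>w\<close> has rank at most
  \<open>\<Sum>\<^sub>k\<^sub>\<le>\<^sub>w (n choose k)\<close>, and a rank bound \<open>B a\<^sup>w\<close> yields \<open>T\<^sub>Q \<le> \<surd>B (q + p \<surd>a)\<^sup>n\<close>.
  For \<open>x \<ge> 4\<close> the Chernoff bound with \<open>a = p powr (-2/3)\<close> gives \<open>ln T\<^sub>Q \<le> 3/2 n p powr (2/3)\<close>, while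
  \<open>(n choose k)\<^sup>2 \<ge> n choose 2k\<close> gives \<open>ln T\<^sub>C \<ge> x/2\<close> as long as \<open>p\<close> is small; for larger \<open>p\<close> the trivial
  speed-up 1 suffices.  For \<open>x \<le> 4\<close> the bound \<open>a = n + 1\<close>, \<open>B = 1\<close> gives \<open>ln T\<^sub>Q \<le> n powr (3/2) p\<close>, while the
  weights 0 and 1 alone give \<open>T\<^sub>C \<ge> 1 + x\<^sup>2/2 (1 - o(1))\<close>; the hypothesis \<open>p \<ge> n\<^sup>-\<^sup>3\<close> enters when \<open>x\<close> is
  small.\<close>

section \<open>Ranks of keys and expected runtimes for an arbitrary finite distribution\<close>

text \<open>Sorting keys by probability and then reading off the probabilities sorts the
  probabilities themselves. Entries of \<open>key_probs\<close> thereby belong to actual keys, with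
  ties broken in some fixed way.\<close>

lemma key_enumeration:
  assumes "finite (set_pmf D)"
  obtains ks where "distinct ks" "set ks = set_pmf D" "key_probs D = map (pmf D) ks"
    "\<And>i j. i \<le> j \<Longrightarrow> j < length ks \<Longrightarrow> pmf D (ks ! j) \<le> pmf D (ks ! i)"
proof -
  obtain xs where xs: "set xs = set_pmf D" "distinct xs"
    using finite_distinct_list[OF assms] by blast
  define ks where "ks = rev (sort_key (pmf D) xs)"
  have "mset_set (set_pmf D) = mset xs"
    using xs by (metis mset_set_set)
  then have "sorted_list_of_multiset (image_mset (pmf D) (mset_set (set_pmf D))) = sort (map (pmf D) xs)"
    by (simp flip: mset_map)
  also have "\<dots> = map (pmf D) (sort_key (pmf D) xs)"
    by (rule properties_for_sort) simp_all
  finally have eq: "key_probs D = map (pmf D) ks"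
    by (simp add: key_probs_def ks_def rev_map)
  have "sorted (rev (map (pmf D) ks))"
    by (simp add: ks_def rev_map)
  then have "pmf D (ks ! j) \<le> pmf D (ks ! i)" if "i \<le> j" "j < length ks" for i j
    using that sorted_rev_nth_mono[of "map (pmf D) ks" i j] by simp
  then show ?thesis
    using that[of ks] xs eq by (simp add: ks_def)
qed

lemma sum_nth_distinct:
  assumes "distinct ks"
  shows "(\<Sum>i<length ks. f (ks ! i)) = (\<Sum>x\<in>set ks. f x)"
  using sum.reindex_bij_betw[OF bij_betw_nth[OF assms refl refl]] .

text \<open>All keys up to and including a given one are at least as likely as it, so its rank is at
  most the size of this upper level set. Ties make this an inequality, but the bound no longer
  refers to an ordering.\<close>

lemma T_Q_le_sum_sqrt_card:
  assumes "finite (set_pmf D)"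
  shows "T_Q D \<le> (\<Sum>x\<in>set_pmf D. sqrt (card {y \<in> set_pmf D. pmf D x \<le> pmf D y}) * pmf D x)"
proof -
  obtain ks where ks: "distinct ks" "set ks = set_pmf D" "key_probs D = map (pmf D) ks"
    "\<And>i j. i \<le> j \<Longrightarrow> j < length ks \<Longrightarrow> pmf D (ks ! j) \<le> pmf D (ks ! i)"
    using key_enumeration[OF assms] by metis
  have rank: "i + 1 \<le> card {y \<in> set_pmf D. pmf D (ks ! i) \<le> pmf D y}" if "i < length ks" for i
  proof -
    have "i + 1 = card ((!) ks ` {..i})"
      using that ks(1) by (subst card_image) (auto simp: inj_on_def nth_eq_iff_index_eq)
    also have "\<dots> \<le> card {y \<in> set_pmf D. pmf D (ks ! i) \<le> pmf D y}"
      using that ks(2,4) assms nth_mem by (intro card_mono) fastforce+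
    finally show ?thesis .
  qed
  have "T_Q D = (\<Sum>i<length ks. sqrt (real (i + 1)) * pmf D (ks ! i))"
    by (simp add: T_Q_def ks(3))
  also have "\<dots> \<le> (\<Sum>i<length ks.
      sqrt (card {y \<in> set_pmf D. pmf D (ks ! i) \<le> pmf D y}) * pmf D (ks ! i))"
    using rank by (intro sum_mono mult_right_mono) (simp_all del: of_nat_Suc of_nat_add)
  also have "\<dots> = (\<Sum>x\<in>set_pmf D. sqrt (card {y \<in> set_pmf D. pmf D x \<le> pmf D y}) * pmf D x)"
    using sum_nth_distinct[OF ks(1)] ks(2) by auto
  finally show ?thesis .
qed

text \<open>The minimum over a pair is the value at the larger index, and \<open>i\<close> is the
  larger index of exactly \<open>2 * i + 1\<close> ordered pairs. The induction adds the last row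
  and column.\<close>

lemma sum_min_descending:
  fixes a :: "nat \<Rightarrow> real"
  assumes "\<And>i j. i \<le> j \<Longrightarrow> j < m \<Longrightarrow> a j \<le> a i"
  shows "(\<Sum>i<m. \<Sum>j<m. min (a i) (a j)) = (\<Sum>i<m. (2 * real i + 1) * a i)"
  using assms
proof (induction m)
  case (Suc m)
  have "min (a i) (a m) = a m" "min (a m) (a i) = a m" if "i < m" for i
    using Suc.prems[of i m] that by auto
  with Suc show ?case
    by (simp add: sum.distrib algebra_simps)
qed simp

text \<open>With indices from 0, twice the rank is \<open>2 * (i + 1) = 1 + (2 * i + 1)\<close>: the
  1 contributes the total mass, the rest the sum of minima. Lower bounds on \<open>T_C\<close> then
  follow by dropping pairs.\<close>

lemma T_C_eq_sum_min:
  assumes "finite (set_pmf D)"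
  shows "2 * T_C D = 1 + (\<Sum>x\<in>set_pmf D. \<Sum>y\<in>set_pmf D. min (pmf D x) (pmf D y))"
proof -
  obtain ks where ks: "distinct ks" "set ks = set_pmf D" "key_probs D = map (pmf D) ks"
    "\<And>i j. i \<le> j \<Longrightarrow> j < length ks \<Longrightarrow> pmf D (ks ! j) \<le> pmf D (ks ! i)"
    using key_enumeration[OF assms] by metis
  define m where "m = length ks"
  have "(\<Sum>i<m. pmf D (ks ! i)) = (\<Sum>x\<in>set_pmf D. pmf D x)"
    using sum_nth_distinct[OF ks(1)] by (simp add: m_def ks(2))
  then have one: "(\<Sum>i<m. pmf D (ks ! i)) = 1"
    by (simp add: sum_pmf_eq_1 assms)
  have "2 * T_C D = (\<Sum>i<m. pmf D (ks ! i)) + (\<Sum>i<m. (2 * real i + 1) * pmf D (ks ! i))"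
    unfolding T_C_def ks(3) sum_distrib_left sum.distrib[symmetric]
    by (rule sum.cong) (auto simp: m_def algebra_simps)
  also have "(\<Sum>i<m. (2 * real i + 1) * pmf D (ks ! i)) =
      (\<Sum>i<m. \<Sum>j<m. min (pmf D (ks ! i)) (pmf D (ks ! j)))"
    using ks(4) by (intro sum_min_descending[symmetric]) (auto simp: m_def)
  also have "\<dots> = (\<Sum>x\<in>set_pmf D. \<Sum>y\<in>set_pmf D. min (pmf D x) (pmf D y))"
    using sum_nth_distinct[OF ks(1), of "\<lambda>y. min (pmf D x) (pmf D y)" for x]
      sum_nth_distinct[OF ks(1), of "\<lambda>x. \<Sum>y\<in>set_pmf D. min (pmf D x) (pmf D y)"]
    by (simp add: m_def ks(2))
  finally show ?thesis
    by (simp add: one)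
qed

text \<open>Makes the denominator of the speed-up positive. Strictness comes from the second key, at
  index 1, whose factor is \<open>sqrt 2\<close>.\<close>

lemma T_Q_gt_1:
  assumes "finite (set_pmf D)" and "card (set_pmf D) > 1"
  shows "T_Q D > 1"
proof -
  obtain ks where ks: "distinct ks" "set ks = set_pmf D" "key_probs D = map (pmf D) ks"
    using key_enumeration[OF assms(1)] by metis
  have len: "length ks > 1"
    using assms(2) distinct_card[OF ks(1)] ks(2) by simp
  have "1 = (\<Sum>i<length ks. pmf D (ks ! i))"
    using sum_nth_distinct[OF ks(1), of "pmf D"] sum_pmf_eq_1[OF assms(1) order_refl]
    by (simp add: ks(2))
  also have "\<dots> < (\<Sum>i<length ks. sqrt (real (i + 1)) * pmf D (ks ! i))"
  proof (rule sum_strict_mono_ex1)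
    show "\<forall>i\<in>{..<length ks}. pmf D (ks ! i) \<le> sqrt (real (i + 1)) * pmf D (ks ! i)"
      by (auto intro!: mult_le_cancel_right1[THEN iffD2])
    have "pmf D (ks ! 1) > 0"
      using len ks(2) by (intro pmf_positive) (metis nth_mem)
    then show "\<exists>i\<in>{..<length ks}. pmf D (ks ! i) < sqrt (real (i + 1)) * pmf D (ks ! i)"
      using len by (intro bexI[of _ 1]) auto
  qed simp
  also have "\<dots> = T_Q D"
    by (simp add: T_Q_def ks(3))
  finally show ?thesis .
qed

lemma T_Q_le_T_C: "T_Q D \<le> T_C D"
proof -
  have nonneg: "0 \<le> key_probs D ! i" if "i < length (key_probs D)" for i
  proof -
    have "set (key_probs D) \<subseteq> range (pmf D)"
      by (auto simp: key_probs_def)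
    with that nth_mem show ?thesis
      by (metis imageE pmf_nonneg subsetD)
  qed
  have "sqrt (real (i + 1)) \<le> real (i + 1)" for i
    by (rule real_le_lsqrt) (auto simp: power2_eq_square)
  with nonneg show ?thesis
    unfolding T_Q_def T_C_def by (intro sum_mono mult_right_mono) auto
qed

section \<open>Bernoulli bit strings grouped by Hamming weight\<close>

lemma pmf_Ber_pow:
  assumes "0 \<le> p" "p \<le> 1" "length l = n"
  shows "pmf (Ber_pow p n) l = p ^ count_list l True * (1 - p) ^ (n - count_list l True)"
  using assms(3)
proof (induction n arbitrary: l)
  case 0
  then show ?case by (simp add: Ber_pow_def)
next
  case (Suc n)
  then obtain b l' where l: "l = b # l'" and len: "length l' = n"
    by (cases l) auto
  have "Ber_pow p (Suc n) = map_pmf (\<lambda>(x, xs). x # xs) (pair_pmf (bernoulli_pmf p) (Ber_pow p n))"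
    by (simp add: Ber_pow_def pair_pmf_def map_bind_pmf map_pmf_def bind_assoc_pmf bind_return_pmf)
  then have "pmf (Ber_pow p (Suc n)) l = pmf (bernoulli_pmf p) b * pmf (Ber_pow p n) l'"
    using pmf_map_inj'[of "\<lambda>(x, xs). x # xs" "pair_pmf (bernoulli_pmf p) (Ber_pow p n)" "(b, l')"]
    by (auto simp: l inj_def pmf_pair)
  moreover have "count_list l' True \<le> n"
    using len count_le_length by metis
  ultimately show ?case
    using Suc.IH[OF len] assms(1,2) by (cases b) (auto simp: l Suc_diff_le)
qed

lemma set_pmf_Ber_pow:
  assumes "0 < p" "p < 1"
  shows "set_pmf (Ber_pow p n) = {l. length l = n}"
  using assms by (auto simp: Ber_pow_def set_replicate_pmf set_pmf_bernoulli)

lemma finite_bit_strings [simp]: "finite {l :: bool list. length l = n}"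
  using finite_lists_length_eq[of "UNIV :: bool set" n] by simp

lemma sum_bit_strings_Suc:
  "(\<Sum>l | length l = Suc n. f l) = (\<Sum>l | length l = n. f (True # l) + f (False # l))"
proof -
  have "{l :: bool list. length l = Suc n} =
      (#) True ` {l. length l = n} \<union> (#) False ` {l. length l = n}"
    by (auto simp: length_Suc_conv image_iff)
  moreover have "(#) True ` {l. length l = n} \<inter> (#) False ` {l. length l = n} = {}"
    by auto
  ultimately show ?thesis
    by (simp add: sum.union_disjoint sum.reindex sum.distrib)
qed

text \<open>Splitting off the first bit gives Pascal's rule; the cardinality is written as a sum of
  indicators so that \<open>sum_bit_strings_Suc\<close> applies.\<close>

lemma card_bit_strings_count:
  "card {l. length l = n \<and> count_list l True = k} = n choose k"
proof -
  have "(\<Sum>l | length l = n. if count_list l True = k then 1 else 0 :: nat) = n choose k"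
  proof (induction n arbitrary: k)
    case (Suc n)
    show ?case
      by (cases k) (simp_all add: sum_bit_strings_Suc sum.distrib Suc.IH)
  qed simp
  then show ?thesis
    by (simp add: sum.If_cases Int_def)
qed

lemma sum_bit_strings_count:
  fixes f :: "nat \<Rightarrow> real"
  shows "(\<Sum>l | length l = n. f (count_list l True)) = (\<Sum>k\<le>n. real (n choose k) * f k)"
proof -
  have "(\<Sum>l | length l = n. f (count_list l True)) =
      (\<Sum>k\<le>n. \<Sum>l \<in> {l \<in> {l. length l = n}. count_list l True = k}. f (count_list l True))"
    using count_le_length by (subst sum.group) auto
  also have "\<dots> = (\<Sum>k\<le>n. real (n choose k) * f k)"
    by (rule sum.cong) (auto simp flip: card_bit_strings_count)
  finally show ?thesis .
qed

lemma card_count_le: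
  "card {l. length l = n \<and> count_list l True \<le> w} = (\<Sum>k\<le>w. n choose k)"
proof -
  have "{l. length l = n \<and> count_list l True \<le> w} =
      (\<Union>k\<le>w. {l. length l = n \<and> count_list l True = k})"
    by auto
  also have "card \<dots> = (\<Sum>k\<le>w. n choose k)"
    by (subst card_UN_disjoint) (auto simp: card_bit_strings_count)
  finally show ?thesis .
qed

section \<open>Runtimes of \<open>Ber_pow\<close> in terms of binomial coefficients\<close>

lemma pow_mult_pow_less:
  fixes p q :: real
  assumes "0 < p" "p < q" "i < j" "j \<le> n"
  shows "p ^ j * q ^ (n - j) < p ^ i * q ^ (n - i)"
proof -
  have "p ^ j = p ^ i * p ^ (j - i)" "q ^ (n - i) = q ^ (j - i) * q ^ (n - j)"
    using assms by (simp_all flip: power_add)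
  moreover have "p ^ (j - i) < q ^ (j - i)"
    using assms by (intro power_strict_mono) auto
  ultimately show ?thesis
    using assms by simp
qed

lemma sum_powers_bit_strings:
  fixes x y :: real
  shows "(\<Sum>l | length l = n. x ^ count_list l True * y ^ (n - count_list l True)) = (x + y) ^ n"
  unfolding sum_bit_strings_count[of "\<lambda>k. x ^ k * y ^ (n - k)"] binomial_ring
  by (simp add: mult.assoc)

text \<open>For \<open>p < 1 / 2\<close> lighter strings are strictly likelier, so the keys at least
  as likely as one of weight \<open>w\<close> lie in the Hamming ball of radius \<open>w\<close>. A
  rank bound geometric in \<open>w\<close> keeps its form under the square root, and the binomial
  theorem sums it in closed form.\<close>

lemma T_Q_Ber_pow_le:
  assumes "0 < p" "p < 1 / 2" "0 \<le> a" "0 \<le> B"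
    and ball: "\<And>w. w \<le> n \<Longrightarrow> real (\<Sum>k\<le>w. n choose k) \<le> B * a ^ w"
  shows "T_Q (Ber_pow p n) \<le> sqrt B * (1 - p + p * sqrt a) ^ n"
proof -
  let ?D = "Ber_pow p n" and ?S = "{l :: bool list. length l = n}" and ?w = "\<lambda>l. count_list l True"
  have S: "set_pmf ?D = ?S"
    using assms by (intro set_pmf_Ber_pow) auto
  have w_le: "?w x \<le> n" if "length x = n" for x
    using count_le_length that by metis
  have pmf: "pmf ?D x = p ^ ?w x * (1 - p) ^ (n - ?w x)" if "length x = n" for x
    using that assms by (intro pmf_Ber_pow) auto
  have rank: "real (card {y \<in> ?S. pmf ?D x \<le> pmf ?D y}) \<le> B * a ^ ?w x" if x: "length x = n" for x
  proof -
    have "?w y \<le> ?w x" if "length y = n" "pmf ?D x \<le> pmf ?D y" for y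
    proof (rule ccontr)
      assume "\<not> ?w y \<le> ?w x"
      then have "pmf ?D y < pmf ?D x"
        using pow_mult_pow_less[of p "1 - p" "?w x" "?w y" n] assms(1,2) w_le[OF that(1)] x that(1)
        by (simp add: pmf)
      with that(2) show False by simp
    qed
    then have "card {y \<in> ?S. pmf ?D x \<le> pmf ?D y} \<le> card {y. length y = n \<and> ?w y \<le> ?w x}"
      by (intro card_mono) auto
    then show ?thesis
      using ball[OF w_le[OF x]] unfolding card_count_le by linarith
  qed
  have "T_Q ?D \<le> (\<Sum>x\<in>?S. sqrt (card {y \<in> ?S. pmf ?D x \<le> pmf ?D y}) * pmf ?D x)"
    using T_Q_le_sum_sqrt_card[of ?D] S by simp
  also have "\<dots> \<le> (\<Sum>x\<in>?S. sqrt (B * a ^ ?w x) * pmf ?D x)"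
    using rank by (intro sum_mono mult_right_mono real_sqrt_le_mono) auto
  also have "\<dots> = (\<Sum>x\<in>?S. sqrt B * ((p * sqrt a) ^ ?w x * (1 - p) ^ (n - ?w x)))"
    by (intro sum.cong)
      (auto simp: pmf real_sqrt_mult real_sqrt_power power_mult_distrib)
  also have "\<dots> = sqrt B * (1 - p + p * sqrt a) ^ n"
    unfolding sum_distrib_left[symmetric] sum_powers_bit_strings by (simp add: add.commute)
  finally show ?thesis .
qed

text \<open>Only pairs of equal weight are kept; there the minimum is the common probability, and
  each \<open>x\<close> has \<open>n choose k\<close> partners.\<close>

lemma T_C_Ber_pow_ge:
  assumes "0 < p" "p < 1"
  shows "1 + (\<Sum>k\<le>n. real (n choose k) ^ 2 * p ^ k * (1 - p) ^ (n - k)) \<le> 2 * T_C (Ber_pow p n)"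
proof -
  let ?D = "Ber_pow p n" and ?S = "{l :: bool list. length l = n}" and ?w = "\<lambda>l. count_list l True"
  have S: "set_pmf ?D = ?S"
    using assms by (intro set_pmf_Ber_pow) auto
  have pmf: "pmf ?D x = p ^ ?w x * (1 - p) ^ (n - ?w x)" if "length x = n" for x
    using that assms by (intro pmf_Ber_pow) auto
  have "(\<Sum>k\<le>n. real (n choose k) ^ 2 * p ^ k * (1 - p) ^ (n - k)) =
      (\<Sum>x\<in>?S. real (n choose ?w x) * (p ^ ?w x * (1 - p) ^ (n - ?w x)))"
    by (subst sum_bit_strings_count[of "\<lambda>k. real (n choose k) * (p ^ k * (1 - p) ^ (n - k))"])
      (simp add: power2_eq_square mult.assoc)
  also have "\<dots> \<le> (\<Sum>x\<in>?S. \<Sum>y\<in>?S. min (pmf ?D x) (pmf ?D y))"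
  proof (rule sum_mono)
    fix x assume x: "x \<in> ?S"
    have "real (n choose ?w x) * (p ^ ?w x * (1 - p) ^ (n - ?w x)) =
        (\<Sum>y | length y = n \<and> ?w y = ?w x. min (pmf ?D x) (pmf ?D y))"
      using x by (simp add: pmf card_bit_strings_count)
    also have "\<dots> \<le> (\<Sum>y\<in>?S. min (pmf ?D x) (pmf ?D y))"
      by (intro sum_mono2) auto
    finally show "real (n choose ?w x) * (p ^ ?w x * (1 - p) ^ (n - ?w x)) \<le>
        (\<Sum>y\<in>?S. min (pmf ?D x) (pmf ?D y))" .
  qed
  finally show ?thesis
    using T_C_eq_sum_min[of ?D] S by simp
qed

section \<open>Estimates for Hamming balls and for sums of squared binomials\<close>

lemma sum_binomial_le_pow:
  assumes "w \<le> n"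
  shows "(\<Sum>k\<le>w. n choose k) \<le> (n + 1) ^ w"
proof -
  have "(\<Sum>k\<le>w. n choose k) \<le> (\<Sum>k\<le>w. (w choose k) * n ^ k)"
  proof (rule sum_mono)
    fix k assume "k \<in> {..w}"
    then have "1 \<le> w choose k" "n choose k \<le> n ^ k"
      using assms by (auto simp: Suc_le_eq zero_less_binomial_iff intro: binomial_le_pow)
    then show "n choose k \<le> (w choose k) * n ^ k"
      using mult_le_mono[of 1 "w choose k" "n choose k" "n ^ k"] by simp
  qed
  also have "\<dots> = (n + 1) ^ w"
    by (simp add: binomial[of n 1 w, simplified])
  finally show ?thesis .
qed

text \<open>Each term may be multiplied by \<open>a ^ (w - k)\<close>, which is at least 1 for
  \<open>k \<le> w\<close>; extending the sum to all \<open>k \<le> n\<close> completes a binomial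
  expansion.\<close>

lemma sum_binomial_le_chernoff:
  fixes a :: real
  assumes "1 \<le> a" "w \<le> n"
  shows "real (\<Sum>k\<le>w. n choose k) \<le> (1 + 1 / a) ^ n * a ^ w"
proof -
  have "real (\<Sum>k\<le>w. n choose k) \<le> (\<Sum>k\<le>w. real (n choose k) * (1 / a) ^ k * a ^ w)"
    unfolding of_nat_sum
  proof (rule sum_mono)
    fix k assume "k \<in> {..w}"
    then have "1 \<le> (1 / a) ^ k * a ^ w"
      using assms(1) power_increasing[of k w a] by (simp add: power_divide)
    then show "real (n choose k) \<le> real (n choose k) * (1 / a) ^ k * a ^ w"
      using mult_left_mono[of 1 "(1 / a) ^ k * a ^ w" "real (n choose k)"] by (simp add: mult.assoc)
  qed
  also have "\<dots> \<le> (\<Sum>k\<le>n. real (n choose k) * (1 / a) ^ k * a ^ w)"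
    using assms by (intro sum_mono2) auto
  also have "\<dots> = (1 + 1 / a) ^ n * a ^ w"
    unfolding add.commute[of 1] binomial_ring by (simp add: sum_distrib_right)
  finally show ?thesis .
qed

text \<open>Choosing \<open>2 * k\<close> elements and then \<open>k\<close> of them amounts to
  choosing two disjoint \<open>k\<close>-sets in order.\<close>

lemma binomial_double_le: "n choose (2 * k) \<le> (n choose k) ^ 2"
proof (cases "2 * k \<le> n")
  case True
  have "n choose (2 * k) \<le> (n choose (2 * k)) * ((2 * k) choose k)"
    by (simp add: Suc_le_eq zero_less_binomial_iff)
  also have "\<dots> = (n choose k) * ((n - k) choose k)"
    using choose_mult[of k "2 * k" n] True by (simp add: mult_2)
  also have "\<dots> \<le> (n choose k) * (n choose k)"
    by (intro mult_le_mono2 binomial_right_mono) simp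
  finally show ?thesis
    by (simp add: power2_eq_square)
qed (simp add: binomial_eq_0)

text \<open>With \<open>r = sqrt p\<close> and \<open>s = sqrt q\<close> the left side is
  \<open>(r + s) ^ n * s ^ n\<close>. The even terms \<open>j = 2 * k\<close> of its expansion carry
  \<open>p ^ k * q ^ (n - k)\<close> with coefficient \<open>n choose (2 * k)\<close>, which
  \<open>binomial_double_le\<close> compares with the square.\<close>

lemma sum_binomial_square_ge:
  fixes p q :: real
  assumes "0 \<le> p" "p \<le> q"
  shows "(q + sqrt (p * q)) ^ n \<le> 2 * (\<Sum>k\<le>n. real (n choose k) ^ 2 * p ^ k * q ^ (n - k))"
proof -
  define r s where "r = sqrt p" and "s = sqrt q"
  have rs: "0 \<le> r" "r \<le> s" "p = r ^ 2" "q = s ^ 2"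
    using assms by (auto simp: r_def s_def)
  let ?f = "\<lambda>j. real (n choose j) * (r ^ j + (- r) ^ j) * s ^ (n - j)"
  have even: "?f (2 * k) * s ^ n \<le> 2 * (real (n choose k) ^ 2 * p ^ k * q ^ (n - k))"
    if "2 * k \<le> n" for k
  proof -
    have "real (n choose (2 * k)) \<le> real (n choose k) ^ 2"
      using binomial_double_le[of n k] by (metis of_nat_le_iff of_nat_power)
    then have le: "real (n choose (2 * k)) * (p ^ k * q ^ (n - k)) \<le>
        real (n choose k) ^ 2 * (p ^ k * q ^ (n - k))"
      using assms by (intro mult_right_mono) auto
    have "s ^ (n - 2 * k) * s ^ n = q ^ (n - k)"
      using that by (simp add: rs(4) diff_mult_distrib2 mult_2 flip: power_add power_mult)
    then have eq: "?f (2 * k) * s ^ n = 2 * (real (n choose (2 * k)) * (p ^ k * q ^ (n - k)))"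
      by (simp add: rs(3) power_mult mult.assoc)
    show ?thesis
      unfolding eq using le by (simp add: mult.assoc)
  qed
  have "(q + sqrt (p * q)) ^ n = (r + s) ^ n * s ^ n"
    using rs by (simp add: real_sqrt_mult algebra_simps power2_eq_square flip: power_mult_distrib)
  \<comment> \<open>Adding the nonnegative \<open>(s - r) ^ n\<close> cancels the odd terms and
    doubles the even ones.\<close>
  also have "\<dots> \<le> ((r + s) ^ n + (- r + s) ^ n) * s ^ n"
    using rs by (intro mult_right_mono) auto
  also have "\<dots> = (\<Sum>j\<le>n. ?f j * s ^ n)"
    unfolding binomial_ring sum.distrib[symmetric] sum_distrib_right
    by (simp only: distrib_left distrib_right)
  also have "\<dots> = (\<Sum>j | j \<le> n \<and> even j. ?f j * s ^ n)"
    by (rule sum.mono_neutral_right) auto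
  also have "{j. j \<le> n \<and> even j} = (*) 2 ` {k. 2 * k \<le> n}"
    by auto
  also have "(\<Sum>j\<in>\<dots>. ?f j * s ^ n) = (\<Sum>k | 2 * k \<le> n. ?f (2 * k) * s ^ n)"
    by (subst sum.reindex) (auto simp: inj_on_def)
  also have "\<dots> \<le> (\<Sum>k | 2 * k \<le> n. 2 * (real (n choose k) ^ 2 * p ^ k * q ^ (n - k)))"
    using even by (intro sum_mono) auto
  also have "\<dots> \<le> (\<Sum>k\<le>n. 2 * (real (n choose k) ^ 2 * p ^ k * q ^ (n - k)))"
    using assms by (intro sum_mono2) auto
  finally show ?thesis
    by (simp add: sum_distrib_left)
qed


section \<open>Bounds on the logarithms of both runtimes\<close>

lemma T_Q_Ber_pow_gt_1:
  assumes "0 < p" "p < 1" "1 \<le> n"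
  shows "1 < T_Q (Ber_pow p n)"
proof (rule T_Q_gt_1)
  have "card {l :: bool list. length l = n} = 2 ^ n"
    using card_lists_length_eq[of "UNIV :: bool set" n] by simp
  then show "1 < card (set_pmf (Ber_pow p n))"
    using assms one_less_power[of "2 :: nat" n] by (simp add: set_pmf_Ber_pow)
qed (use assms in \<open>simp add: set_pmf_Ber_pow\<close>)

text \<open>The Chernoff ball bound yields the exponent
  \<open>n * (1 / (2 * a) + p * sqrt a)\<close>. It is minimal at
  \<open>a = p powr (- 2 / 3)\<close>, where \<open>1 / a\<close> and \<open>p * sqrt a\<close> both
  equal \<open>p powr (2 / 3)\<close>.\<close>

lemma ln_T_Q_Ber_pow_le_powr:
  assumes "0 < p" "p < 1 / 2" "1 \<le> n"
  shows "ln (T_Q (Ber_pow p n)) \<le> 3 / 2 * real n * p powr (2 / 3)"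
proof -
  define a where "a = p powr (- 2 / 3)"
  have a: "1 \<le> a"
    using assms powr_mono2'[of "- 2 / 3" p 1] by (simp add: a_def)
  have inv: "1 / a = p powr (2 / 3)"
    by (simp add: a_def powr_minus_divide)
  have "sqrt a = p powr (- 1 / 3)"
    by (simp add: a_def powr_half_sqrt[symmetric] powr_powr)
  then have psa: "p * sqrt a = p powr (2 / 3)"
    using assms powr_mult_base[of p "- 1 / 3"] by simp
  have "T_Q (Ber_pow p n) \<le> sqrt ((1 + 1 / a) ^ n) * (1 - p + p * sqrt a) ^ n"
    using assms a by (intro T_Q_Ber_pow_le sum_binomial_le_chernoff) auto
  also have "\<dots> \<le> sqrt (exp (1 / a) ^ n) * exp (p * sqrt a) ^ n"
  proof (intro mult_mono real_sqrt_le_mono power_mono)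
    show "1 - p + p * sqrt a \<le> exp (p * sqrt a)"
      using exp_ge_add_one_self[of "p * sqrt a"] assms by linarith
  qed (use a assms in auto)
  also have "\<dots> = exp (3 / 2 * real n * p powr (2 / 3))"
    unfolding psa inv
    by (simp add: powr_half_sqrt[symmetric] exp_powr_real flip: exp_of_nat_mult exp_add)
  finally have "exp (ln (T_Q (Ber_pow p n))) \<le> exp (3 / 2 * real n * p powr (2 / 3))"
    using T_Q_Ber_pow_gt_1[of p n] assms by simp
  then show ?thesis
    by (simp only: exp_le_cancel_iff)
qed

lemma ln_T_Q_Ber_pow_le_linear:
  assumes "0 < p" "p < 1 / 2" "1 \<le> n"
  shows "ln (T_Q (Ber_pow p n)) \<le> real n * sqrt (real n) * p"
proof -
  have "T_Q (Ber_pow p n) \<le> sqrt 1 * (1 - p + p * sqrt (real n + 1)) ^ n"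
  proof (rule T_Q_Ber_pow_le)
    fix w assume "w \<le> n"
    then show "real (\<Sum>k\<le>w. n choose k) \<le> 1 * (real n + 1) ^ w"
      using sum_binomial_le_pow[of w n] by (metis mult_1 of_nat_1 of_nat_add of_nat_le_iff of_nat_power)
  qed (use assms in auto)
  also have "\<dots> \<le> exp (p * sqrt (real n)) ^ n"
  proof -
    \<comment> \<open>The extra 1, multiplied by \<open>p\<close>, is absorbed by the
      \<open>- p\<close> in the base.\<close>
    have "sqrt (real n + 1) \<le> sqrt (real n) + 1"
      using sqrt_add_le_add_sqrt[of "real n" 1] by simp
    then have "p * sqrt (real n + 1) \<le> p * (sqrt (real n) + 1)"
      using assms by (intro mult_left_mono) auto
    then have "1 - p + p * sqrt (real n + 1) \<le> exp (p * sqrt (real n))"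
      using exp_ge_add_one_self[of "p * sqrt (real n)"] unfolding distrib_left by linarith
    then show ?thesis
      using assms by (simp add: power_mono)
  qed
  also have "\<dots> = exp (real n * sqrt (real n) * p)"
    by (simp add: mult_ac flip: exp_of_nat_mult)
  finally have "exp (ln (T_Q (Ber_pow p n))) \<le> exp (real n * sqrt (real n) * p)"
    using T_Q_Ber_pow_gt_1[of p n] assms by simp
  then show ?thesis
    by (simp only: exp_le_cancel_iff)
qed

text \<open>The base \<open>1 - p + sqrt (p * (1 - p))\<close> is about \<open>1 + sqrt p\<close>,
  which gives \<open>ln T_C\<close> at least \<open>9 / 10 * n * sqrt p - ln 4\<close>. The
  hypothesis \<open>4 \<le> n * sqrt p\<close> lets the surplus \<open>4 / 10 * n * sqrt p\<close>
  pay for \<open>ln 4\<close>.\<close>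

lemma ln_T_C_Ber_pow_ge_sqrt:
  assumes "0 < p" "p \<le> 1 / 729" "4 \<le> real n * sqrt p"
  shows "real n * sqrt p / 2 \<le> ln (T_C (Ber_pow p n))"
proof -
  define y where "y = sqrt p"
  have y: "0 < y" "p = y ^ 2" "y \<le> 1 / 27"
    using assms real_sqrt_le_mono[of p "1 / 729"] real_sqrt_unique[of "1 / 27" "1 / 729"]
    by (auto simp: y_def power2_eq_square)
  have "1 - p \<le> sqrt (1 - p)"
    using assms by (intro real_le_rsqrt) (simp add: power2_eq_square mult_left_le)
  then have "1 - p + (1 - p) * y \<le> 1 - p + sqrt (p * (1 - p))"
    using y by (simp add: real_sqrt_mult mult.commute flip: y_def)
  moreover have "1 + 96 / 100 * y \<le> 1 - p + (1 - p) * y"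
  proof -
    \<comment> \<open>The loss in
      \<open>(1 - y ^ 2) * (1 + y) = 1 + y - y * (y + y ^ 2)\<close>.\<close>
    have "y * (y + y ^ 2) \<le> y * (4 / 100)"
    proof (rule mult_left_mono)
      have "y ^ 2 \<le> 1 / 729" using assms y by simp
      then show "y + y ^ 2 \<le> 4 / 100" using y by linarith
    qed (use y in simp)
    then show ?thesis
      by (simp add: y(2) power2_eq_square algebra_simps)
  qed
  ultimately have "1 + 96 / 100 * y \<le> 1 - p + sqrt (p * (1 - p))"
    by linarith
  then have "(1 + 96 / 100 * y) ^ n \<le> (1 - p + sqrt (p * (1 - p))) ^ n"
    using y by (intro power_mono) auto
  also have "\<dots> \<le> 2 * (\<Sum>k\<le>n. real (n choose k) ^ 2 * p ^ k * (1 - p) ^ (n - k))"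
    using assms by (intro sum_binomial_square_ge) auto
  also have "\<dots> \<le> 4 * T_C (Ber_pow p n)"
    using T_C_Ber_pow_ge[of p n] assms by linarith
  finally have TC: "(1 + 96 / 100 * y) ^ n / 4 \<le> T_C (Ber_pow p n)"
    by simp
  have "9 / 10 * y \<le> 96 / 100 * y - (96 / 100 * y) ^ 2"
  proof -
    have "y * y \<le> y * (1 / 27)"
      using y by (intro mult_left_mono) auto
    moreover have "(96 / 100 * y) ^ 2 = 9216 / 10000 * (y * y)"
      by (simp add: power2_eq_square)
    ultimately show ?thesis
      using y(1) by linarith
  qed
  also have "\<dots> \<le> ln (1 + 96 / 100 * y)"
    using y by (intro ln_one_plus_pos_lower_bound) auto
  finally have "real n * (9 / 10 * y) \<le> real n * ln (1 + 96 / 100 * y)"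
    by (intro mult_left_mono) auto
  moreover have "ln 4 = 2 * ln (2 :: real)"
    using ln_powr[of 2 2] by simp
  moreover have "ln ((1 + 96 / 100 * y) ^ n / 4) = real n * ln (1 + 96 / 100 * y) - ln 4"
    using y by (simp add: ln_div ln_realpow)
  moreover have "ln ((1 + 96 / 100 * y) ^ n / 4) \<le> ln (T_C (Ber_pow p n))"
    using y by (intro ln_mono TC) auto
  ultimately show ?thesis
    using assms(3) ln2_le_25_over_36 unfolding y_def by linarith
qed

text \<open>Weights 0 and 1 alone, with Bernoulli's inequality for the powers of
  \<open>1 - p\<close>. The \<open>1 / n\<close> term is the loss \<open>n * p\<close> from weight
  0.\<close>

lemma T_C_Ber_pow_ge_quadratic:
  assumes "0 < p" "p < 1" "1 \<le> n"
  shows "1 + real n ^ 2 * p / 2 * (1 - 1 / real n - real n * p) \<le> T_C (Ber_pow p n)"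
proof -
  have bern: "1 - real m * p \<le> (1 - p) ^ m" for m
    using Bernoulli_inequality[of "- p" m] assms by simp
  have "(1 - p) ^ n \<le> (1 - p) ^ (n - 1)"
    using assms by (intro power_decreasing) auto
  then have "1 - real n * p \<le> (1 - p) ^ (n - 1)"
    using bern[of n] by linarith
  then have "real n ^ 2 * p * (1 - real n * p) \<le> real n ^ 2 * p * (1 - p) ^ (n - 1)"
    using assms by (intro mult_left_mono) auto
  moreover have "(1 - p) ^ n + real n ^ 2 * p * (1 - p) ^ (n - 1) =
      (\<Sum>k\<in>{0, 1}. real (n choose k) ^ 2 * p ^ k * (1 - p) ^ (n - k))"
    by simp
  moreover have "\<dots> \<le> (\<Sum>k\<le>n. real (n choose k) ^ 2 * p ^ k * (1 - p) ^ (n - k))"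
    using assms by (intro sum_mono2) auto
  ultimately have "1 + (1 - real n * p + real n ^ 2 * p * (1 - real n * p)) \<le> 2 * T_C (Ber_pow p n)"
    using T_C_Ber_pow_ge[of p n] bern[of n] assms by linarith
  moreover have "1 + (1 - real n * p + real n ^ 2 * p * (1 - real n * p)) =
      2 * (1 + real n ^ 2 * p / 2 * (1 - 1 / real n - real n * p))"
    using assms by (simp add: field_simps power2_eq_square)
  ultimately have "2 * (1 + real n ^ 2 * p / 2 * (1 - 1 / real n - real n * p)) \<le> 2 * T_C (Ber_pow p n)"
    by metis
  then show ?thesis
    by (rule mult_left_le_imp_le) simp
qed

section \<open>From runtime bounds to the speed-up\<close>

lemma speedup_geI:
  assumes "0 < p" "p < 1" "1 \<le> n" "0 \<le> r"
    and "ln (T_Q (Ber_pow p n)) \<le> u" "r * u \<le> ln (T_C (Ber_pow p n))"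
  shows "r \<le> quantum_speedup (Ber_pow p n)"
proof -
  have "0 < ln (T_Q (Ber_pow p n))"
    using T_Q_Ber_pow_gt_1[of p n] assms by simp
  moreover have "r * ln (T_Q (Ber_pow p n)) \<le> ln (T_C (Ber_pow p n))"
    using assms mult_left_mono[of "ln (T_Q (Ber_pow p n))" u r] by linarith
  ultimately show ?thesis
    by (simp add: quantum_speedup_def log_def field_simps)
qed

lemma speedup_ge_of_large_n:
  fixes p :: real
  assumes p: "0 < p" "p \<le> 1 / 2" "1 / real n ^ 3 \<le> p" and n: "425 \<le> n"
    and n': "1 / 3 * (real n * sqrt (real n) * (16 / real n ^ 2) powr (5 / 6)) \<le> 1 / 10"
  shows "1 / 3 * p powr (- 1 / 6) \<le> quantum_speedup (Ber_pow p n)"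
proof -
  define r where "r = 1 / 3 * p powr (- 1 / 6)"
  have r: "0 \<le> r"
    by (simp add: r_def)
  have n1: "1 \<le> n"
    using n by simp
  \<comment> \<open>Since \<open>729 = 3 ^ 6\<close>, the claimed bound is at most 1 exactly in the
    first case. That case also covers \<open>p = 1 / 2\<close>, so the others satisfy the strict
    \<open>p < 1 / 2\<close> of the \<open>T_Q\<close> bounds.\<close>
  consider "1 / 729 \<le> p" | "p \<le> 1 / 729" "4 \<le> real n * sqrt p"
    | "p \<le> 1 / 729" "real n * sqrt p \<le> 4"
    by linarith
  then have "r \<le> quantum_speedup (Ber_pow p n)"
  proof cases
    case 1
    have "p powr (- 1 / 6) \<le> (1 / 729) powr (- 1 / 6)"
      using 1 p by (intro powr_mono2') auto
    also have "(1 / 729 :: real) = 3 powr (- 6)"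
      by (simp add: powr_minus powr_numeral)
    finally have "r \<le> 1"
      by (simp add: r_def powr_powr)
    have TQ: "1 < T_Q (Ber_pow p n)"
      using p n1 by (intro T_Q_Ber_pow_gt_1) auto
    then have "ln (T_Q (Ber_pow p n)) \<le> ln (T_C (Ber_pow p n))"
      using T_Q_le_T_C[of "Ber_pow p n"] by (intro ln_mono) auto
    moreover have "r * ln (T_Q (Ber_pow p n)) \<le> 1 * ln (T_Q (Ber_pow p n))"
      using TQ \<open>r \<le> 1\<close> by (intro mult_right_mono) auto
    ultimately show ?thesis
      using p n1 r by (intro speedup_geI[OF _ _ _ _ order_refl]) auto
  next
    case 2
    \<comment> \<open>The factor \<open>1 / 3\<close> turns \<open>3 / 2\<close> into
      \<open>1 / 2\<close>, matching the lower bound for \<open>ln T_C\<close> exactly.\<close>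
    have "r * (3 / 2 * real n * p powr (2 / 3)) = real n * (p powr (- 1 / 6) * p powr (2 / 3)) / 2"
      by (simp add: r_def)
    also have "p powr (- 1 / 6) * p powr (2 / 3) = sqrt p"
      using p by (simp add: powr_half_sqrt flip: powr_add)
    also have "real n * sqrt p / 2 \<le> ln (T_C (Ber_pow p n))"
      using 2 p by (intro ln_T_C_Ber_pow_ge_sqrt) auto
    finally show ?thesis
      using 2 p n1 r by (intro speedup_geI[OF _ _ _ _ ln_T_Q_Ber_pow_le_powr]) auto
  next
    case 3
    let ?z = "real n ^ 2 * p"
    have "(real n * sqrt p) ^ 2 \<le> 4 ^ 2"
      using 3 p by (intro power_mono) auto
    then have z: "?z \<le> 16" "0 < ?z"
      using p n by (auto simp: power_mult_distrib)
    have "real n * p \<le> 16 / real n"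
      using z n by (simp add: field_simps power2_eq_square)
    \<comment> \<open>Equality holds at \<open>n = 425\<close>, the origin of that
      threshold.\<close>
    moreover have "17 / real n \<le> 4 / 100"
      using n by (simp add: field_simps)
    ultimately have "96 / 100 \<le> 1 - 1 / real n - real n * p"
      by simp
    then have "?z / 2 * (96 / 100) \<le> ?z / 2 * (1 - 1 / real n - real n * p)"
      using z by (intro mult_left_mono) auto
    then have TC: "1 + 48 / 100 * ?z \<le> T_C (Ber_pow p n)"
      using T_C_Ber_pow_ge_quadratic[of p n] p n by linarith
    have "r * (real n * sqrt (real n) * p) \<le> ln (T_C (Ber_pow p n))"
    \<comment> \<open>For small \<open>?z\<close> both sides are linear in \<open>?z\<close>, with
      slopes \<open>1 / 3\<close> against about \<open>48 / 100\<close>. Otherwise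
      \<open>ln T_C\<close> is bounded below by a constant, while the left side is of order
      \<open>n powr (- 1 / 6)\<close>.\<close>
    proof (cases "?z \<le> 1 / 4")
      case True
      \<comment> \<open>The bound \<open>p \<ge> 1 / n ^ 3\<close> says that
        \<open>p powr (- 1 / 6)\<close> is at most \<open>sqrt n\<close>.\<close>
      have "p powr (- 1 / 6) \<le> (1 / real n ^ 3) powr (- 1 / 6)"
        using p n by (intro powr_mono2') auto
      also have "1 / real n ^ 3 = real n powr (- 3)"
        using n by (simp add: powr_minus_divide powr_numeral)
      finally have "r \<le> 1 / 3 * sqrt (real n)"
        by (simp add: r_def powr_powr powr_half_sqrt)
      then have "r * (real n * sqrt (real n) * p) \<le> 1 / 3 * sqrt (real n) * (real n * sqrt (real n) * p)"
        using p by (intro mult_right_mono) auto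
      also have "\<dots> = 1 / 3 * ?z"
        by (simp add: power2_eq_square)
      also have "\<dots> \<le> 48 / 100 * ?z - (48 / 100 * ?z) ^ 2"
        using mult_left_mono[OF True, of ?z] z(2) by (simp add: power2_eq_square)
      also have "\<dots> \<le> ln (1 + 48 / 100 * ?z)"
        using True z by (intro ln_one_plus_pos_lower_bound) auto
      also have "\<dots> \<le> ln (T_C (Ber_pow p n))"
        using z TC by (intro ln_mono) auto
      finally show ?thesis .
    next
      case False
      have "p powr (- 1 / 6) * p = p powr (5 / 6)"
        using p powr_mult_base[of p "- 1 / 6"] by (simp add: mult.commute)
      moreover have "p powr (5 / 6) \<le> (16 / real n ^ 2) powr (5 / 6)"
        using z n p by (intro powr_mono2) (auto simp: field_simps)
      ultimately have "1 / 3 * (real n * sqrt (real n) * (p powr (- 1 / 6) * p)) \<le>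
          1 / 3 * (real n * sqrt (real n) * (16 / real n ^ 2) powr (5 / 6))"
        by (intro mult_left_mono) auto
      then have "r * (real n * sqrt (real n) * p) \<le>
          1 / 3 * (real n * sqrt (real n) * (16 / real n ^ 2) powr (5 / 6))"
        by (simp add: r_def mult_ac)
      \<comment> \<open>Here \<open>12 / 100\<close> is \<open>48 / 100 * ?z\<close> at
        \<open>?z = 1 / 4\<close>, and the right side exceeds the \<open>1 / 10\<close> allowed by
        \<open>n'\<close>.\<close>
      also have "\<dots> \<le> 12 / 100 - (12 / 100) ^ 2"
        using n' by (simp add: power2_eq_square)
      also have "\<dots> \<le> ln (1 + 12 / 100 :: real)"
        by (intro ln_one_plus_pos_lower_bound) auto
      also have "\<dots> \<le> ln (T_C (Ber_pow p n))"
        using TC False by (intro ln_mono) auto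
      finally show ?thesis .
    qed
    then show ?thesis
      using 3 p n1 r by (intro speedup_geI[OF _ _ _ _ ln_T_Q_Ber_pow_le_linear]) auto
  qed
  then show ?thesis
    by (simp add: r_def)
qed

lemma eventually_speedup_ge:
  fixes p :: "nat \<Rightarrow> real"
  assumes "\<And>n. 0 < p n" "\<And>n. p n \<le> 1 / 2" "\<forall>\<^sub>F n in sequentially. 1 / real n ^ 3 \<le> p n"
  shows "\<forall>\<^sub>F n in sequentially. quantum_speedup (Ber_pow (p n) n) \<ge> 1 / 3 * p n powr (- 1 / 6)"
proof -
  have "\<forall>\<^sub>F n in sequentially.
      1 / 3 * (real n * sqrt (real n) * (16 / real n ^ 2) powr (5 / 6)) \<le> 1 / 10"
    by real_asymp
  with assms(3) eventually_ge_at_top[of 425] show ?thesis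
    by eventually_elim (use assms speedup_ge_of_large_n in auto)
qed

text \<open>For fixed \<open>n\<close> the speed-up stays bounded as \<open>p\<close> tends to 0
  whereas \<open>p powr (- 1 / 6)\<close> does not, so the first claim asks for a polynomial lower
  bound on \<open>p\<close>; in the second, the \<open>\<Theta>\<close> condition supplies
  it.\<close>

theorem lemma5p1:
  fixes p :: "nat \<Rightarrow> real"
  assumes "\<And>n. 0 < p n" and "\<And>n. p n \<le> 1 / 2"
  shows "((\<forall>\<^sub>F n in sequentially. 1 / real n ^ 3 \<le> p n) \<longrightarrow>
           (\<forall>\<^sub>F n in sequentially. quantum_speedup (Ber_pow (p n) n) \<ge> 1 / 3 * p n powr (- 1 / 6)))
       \<and> (p \<in> \<Theta>(\<lambda>n. real n powr (- 1 / 2)) \<longrightarrow>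
           (\<lambda>n. quantum_speedup (Ber_pow (p n) n)) \<in> \<Omega>(\<lambda>n. real n powr (1 / 12)))"
proof (intro conjI impI)
  assume "\<forall>\<^sub>F n in sequentially. 1 / real n ^ 3 \<le> p n"
  with assms show "\<forall>\<^sub>F n in sequentially. quantum_speedup (Ber_pow (p n) n) \<ge> 1 / 3 * p n powr (- 1 / 6)"
    by (rule eventually_speedup_ge)
next
  assume theta: "p \<in> \<Theta>(\<lambda>n. real n powr (- 1 / 2))"
  obtain c where c: "c > 0" "\<forall>\<^sub>F n in sequentially. norm (p n) \<ge> c * norm (real n powr (- 1 / 2))"
    using theta landau_omega.bigE by (metis bigthetaD2)
  obtain d where d: "d > 0" "\<forall>\<^sub>F n in sequentially. norm (p n) \<le> d * norm (real n powr (- 1 / 2))"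
    using theta landau_o.bigE by (metis bigthetaD1)
  have "\<forall>\<^sub>F n in sequentially. 1 / real n ^ 3 \<le> c * real n powr (- 1 / 2)"
    using c(1) by real_asymp
  with c(2) have "\<forall>\<^sub>F n in sequentially. 1 / real n ^ 3 \<le> p n"
    by eventually_elim (use assms in \<open>auto simp: less_imp_le intro: order_trans\<close>)
  with assms have "\<forall>\<^sub>F n in sequentially. quantum_speedup (Ber_pow (p n) n) \<ge> 1 / 3 * p n powr (- 1 / 6)"
    by (rule eventually_speedup_ge)
  with d(2) eventually_gt_at_top[of 0]
  have "\<forall>\<^sub>F n in sequentially. 1 / 3 * d powr (- 1 / 6) * norm (real n powr (1 / 12)) \<le>
      norm (quantum_speedup (Ber_pow (p n) n))"
  proof eventually_elim
    case (elim n)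
    \<comment> \<open>The negative exponent turns the upper bound on \<open>p\<close> into a lower
      bound, and \<open>(- 1 / 2) * (- 1 / 6) = 1 / 12\<close>.\<close>
    have "(d * real n powr (- 1 / 2)) powr (- 1 / 6) \<le> p n powr (- 1 / 6)"
      using elim assms(1)[of n] by (intro powr_mono2') auto
    then have "d powr (- 1 / 6) * real n powr (1 / 12) \<le> p n powr (- 1 / 6)"
      using d(1) by (simp add: powr_mult powr_powr)
    with elim show ?case
      by simp
  qed
  then show "(\<lambda>n. quantum_speedup (Ber_pow (p n) n)) \<in> \<Omega>(\<lambda>n. real n powr (1 / 12))"
    using d(1) by (intro landau_omega.bigI[of "1 / 3 * d powr (- 1 / 6)"]) auto
qed

end
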